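(* There exist a semimartingale $Y$ and a sequence $(X^{n})_{n=1}^{\infty}$ of semimartingales starting at zero such that the following hold. 1. $\sup_{n}\int_{\Omega}\mathrm{var}(X^{n})_{\infty}\,d\mathbb{P}\leq 1$. 2. For every sequence $(\widetilde{X}^{n})_{n=1}^{\infty}$ with $\widetilde{X}^{n}\in\mathrm{co}\{X^{m}:m\geq n\}$ for all $n$, one has $$Y=\lim_{s\downarrow\cdot,\,s\in\mathbb{Q}_{+}}\ \lim_{n\to\infty}\widetilde{X}^{n}_{s}.$$ 3. For every sequence $(\widetilde{X}^{n})_{n=1}^{\infty}$ with $\widetilde{X}^{n}\in\mathrm{co}\{X^{m}:m\geq n\}$ for all $n$, one has $$\lim_{s\downarrow\cdot,\,s\in\mathbb{Q}_{+}}\ \lim_{n\to\infty}\int_{0}^{s}Y_{-}\,d\widetilde{X}^{n}=\int_{0}^{\cdot}Y_{-}\,dY,$$ $$\lim_{s\downarrow\cdot,\,s\in\mathbb{Q}_{+}}\ \lim_{n\to\infty}[\widetilde{X}^{n},Y]_{s}\neq[Y,Y],$$ $$\lim_{s\downarrow\cdot,\,s\in\mathbb{Q}_{+}}\ \lim_{n\to\infty}\int_{0}^{s}\widetilde{X}^{n}_{-}\,dY\neq\int_{0}^{\cdot}Y_{-}\,dY.$$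
   Context: $(\Omega,\mathscr{F},\mathbb{P})$ is a probability space with a filtration $\mathbb{F}=(\mathscr{F}_{t})_{t\in[0,\infty)}$ satisfying the usual conditions, with $\mathscr{F}_{0}$ the $\mathbb{P}$-augmentation of the trivial $\sigma$-algebra. Semimartingales (càdlàg) are relative to $\mathbb{F}$; processes are identified up to evanescence (indistinguishability). $\int_{0}^{\cdot}\xi\,dX$ is the Itô stochastic integral and $[X,Y]$ is the quadratic covariation. $Z_{-}$ is the left-limit process of $Z$, with $Z_{0-}=Z_{0}$. $\mathrm{var}(X)_t$ is the total variation of the paths of $X$ on $[0,t]$ and $\mathrm{var}(X)_\infty=\lim_{t\to\infty}\mathrm{var}(X)_t$. $\mathrm{co}$ denotes the convex hull (finite convex combinations). $\mathbb{Q}_{+}$ is the set of nonnegative rationals. $\lim_{n\to\infty}$ of random variables denotes the $\mathbb{P}$-a.s. limit. The process $\lim_{s\downarrow\cdot,\,s\in\mathbb{Q}_{+}}\lim_{n\to\infty}Z^{n}_{s}$ is defined as follows: for each $s\in\mathbb{Q}_{+}$, $\zeta_{s}=\lim_{n}Z^{n}_{s}$ exists $\mathbb{P}$-a.s., and, $\mathbb{P}$-a.s., for every $t\in[0,\infty)$ its value at $t$ is the limit of $\zeta_{s}$ as $s\in\mathbb{Q}_{+}$, $s>t$, $s\to t$. Existence of the displayed limits is part of the assertions; $=$ means indistinguishable, and $\neq$ means not indistinguishable. *)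

theory Defs
  imports "HOL-Probability.Probability"
begin

text \<open>
  Time is modelled by real numbers, and only the times in \<open>[0, \<infinity>)\<close> matter: no notion below depends
  on a process at negative times. The library's \<open>filtration\<close> and \<open>stopping_time\<close> range over the
  whole index type; since every stopping time used here is nonnegative, the \<open>\<sigma>\<close>-algebras at
  negative times impose no condition.

  Processes are identified up to evanescence. All path properties are therefore required almost
  surely, and so they do not depend on the choice of a representative.
\<close>

type_synonym 'a process = "real \<Rightarrow> 'a \<Rightarrow> real"

text \<open>The last assumption says that \<open>F 0\<close> is the augmentation of the trivial \<open>\<sigma>\<close>-algebra; it
  contains the requirement of the usual conditions that \<open>F 0\<close> contain all null sets.\<close>

locale usual_filtered_prob_space =
  prob_space M + complete_measure M + filtration "space M" F
  for M :: "'a measure" and F :: "real \<Rightarrow> 'a measure" +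
  assumes subalgebra_F: "\<And>t. subalgebra M (F t)"
    and right_continuous_F: "\<And>t. 0 \<le> t \<Longrightarrow> sets (F t) = (\<Inter>u\<in>{t<..}. sets (F u))"
    and sets_F_0: "sets (F 0) = sigma_sets (space M) (null_sets M)"

definition indistinguishable :: "'a measure \<Rightarrow> 'a process \<Rightarrow> 'a process \<Rightarrow> bool" where
  "indistinguishable M X Y \<longleftrightarrow> (AE \<omega> in M. \<forall>t\<ge>0. X t \<omega> = Y t \<omega>)"

subsection \<open>Semimartingales\<close>

definition cadlag :: "(real \<Rightarrow> real) \<Rightarrow> bool" where
  "cadlag f \<longleftrightarrow> (\<forall>t\<ge>0. (f \<longlongrightarrow> f t) (at_right t)) \<and> (\<forall>t>0. \<exists>l. (f \<longlongrightarrow> l) (at_left t))"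

definition cadlag_adapted :: "'a measure \<Rightarrow> (real \<Rightarrow> 'a measure) \<Rightarrow> 'a process \<Rightarrow> bool" where
  "cadlag_adapted M F X \<longleftrightarrow>
     (\<forall>t\<ge>0. X t \<in> borel_measurable (F t)) \<and> (AE \<omega> in M. cadlag (\<lambda>t. X t \<omega>))"

definition martingale :: "'a measure \<Rightarrow> (real \<Rightarrow> 'a measure) \<Rightarrow> 'a process \<Rightarrow> bool" where
  "martingale M F X \<longleftrightarrow>
     (\<forall>t\<ge>0. X t \<in> borel_measurable (F t) \<and> integrable M (X t)) \<and>
     (\<forall>s\<ge>0. \<forall>t\<ge>s. AE \<omega> in M. real_cond_exp M (F s) (X t) \<omega> = X s \<omega>)"

definition local_martingale :: "'a measure \<Rightarrow> (real \<Rightarrow> 'a measure) \<Rightarrow> 'a process \<Rightarrow> bool" where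
  "local_martingale M F X \<longleftrightarrow> cadlag_adapted M F X \<and>
     (\<exists>T :: nat \<Rightarrow> 'a \<Rightarrow> real.
        (\<forall>n. stopping_time F (T n) \<and> (\<forall>\<omega>\<in>space M. 0 \<le> T n \<omega>)) \<and>
        (AE \<omega> in M. incseq (\<lambda>n. T n \<omega>) \<and> filterlim (\<lambda>n. T n \<omega>) at_top sequentially) \<and>
        (\<forall>n. martingale M F (\<lambda>t \<omega>. X (min t (T n \<omega>)) \<omega> - X 0 \<omega>)))"

text \<open>Every finite partition of \<open>[0, t]\<close> is an initial segment of some nondecreasing sequence in
  \<open>[0, t]\<close>.\<close>

definition path_variation :: "(real \<Rightarrow> real) \<Rightarrow> real \<Rightarrow> ennreal" where
  "path_variation f t =
     (SUP (n, p) \<in> {(n :: nat, p :: nat \<Rightarrow> real). mono p \<and> range p \<subseteq> {0..t}}.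
        \<Sum>i<n. ennreal \<bar>f (p (Suc i)) - f (p i)\<bar>)"

definition total_variation :: "(real \<Rightarrow> real) \<Rightarrow> ennreal" where
  "total_variation f = Lim at_top (path_variation f)"

definition finite_variation_process :: "'a measure \<Rightarrow> (real \<Rightarrow> 'a measure) \<Rightarrow> 'a process \<Rightarrow> bool" where
  "finite_variation_process M F A \<longleftrightarrow> cadlag_adapted M F A \<and>
     (AE \<omega> in M. \<forall>t\<ge>0. path_variation (\<lambda>s. A s \<omega>) t < \<infinity>)"

definition semimartingale :: "'a measure \<Rightarrow> (real \<Rightarrow> 'a measure) \<Rightarrow> 'a process \<Rightarrow> bool" where
  "semimartingale M F X \<longleftrightarrow> cadlag_adapted M F X \<and>
     (\<exists>N A. local_martingale M F N \<and> finite_variation_process M F A \<and>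
        (AE \<omega> in M. N 0 \<omega> = 0 \<and> A 0 \<omega> = 0) \<and>
        indistinguishable M X (\<lambda>t \<omega>. X 0 \<omega> + N t \<omega> + A t \<omega>))"

definition left_limit :: "'a process \<Rightarrow> 'a process" where
  "left_limit Z t \<omega> = (if t \<le> 0 then Z 0 \<omega> else Lim (at_left t) (\<lambda>s. Z s \<omega>))"

subsection \<open>Stochastic integral and quadratic covariation\<close>

text \<open>A record \<open>S\<close> encodes the simple predictable process
  \<open>h0 1_{0} + (\<Sum>i<n. h i 1_(T i, T (i+1)])\<close> with \<open>T 0 \<le> \<dots> \<le> T n\<close> finite stopping times and
  \<open>h i\<close> measurable with respect to the \<open>\<sigma>\<close>-algebra of the events prior to \<open>T i\<close>.\<close>

record 'a simple_integrand =
  init :: "'a \<Rightarrow> real"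
  steps :: nat
  time :: "nat \<Rightarrow> 'a \<Rightarrow> real"
  coef :: "nat \<Rightarrow> 'a \<Rightarrow> real"

definition simple_predictable ::
    "'a measure \<Rightarrow> (real \<Rightarrow> 'a measure) \<Rightarrow> 'a simple_integrand \<Rightarrow> bool" where
  "simple_predictable M F S \<longleftrightarrow>
     init S \<in> borel_measurable (F 0) \<and>
     (\<forall>i\<le>steps S. stopping_time F (time S i) \<and> (\<forall>\<omega>\<in>space M. 0 \<le> time S i \<omega>)) \<and>
     (\<forall>i<steps S. (\<forall>\<omega>\<in>space M. time S i \<omega> \<le> time S (Suc i) \<omega>) \<and>
        coef S i \<in> borel_measurable (filtration.pre_sigma (space M) F (time S i)))"

definition simple_process :: "'a simple_integrand \<Rightarrow> 'a process" where
  "simple_process S t \<omega> = init S \<omega> * indicator {0} t +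
     (\<Sum>i<steps S. coef S i \<omega> * indicator {time S i \<omega> <.. time S (Suc i) \<omega>} t)"

text \<open>Integrals are over \<open>(0, t]\<close>, in accordance with the convention \<open>Z_{0-} = Z_0\<close>.\<close>

definition simple_integral :: "'a simple_integrand \<Rightarrow> 'a process \<Rightarrow> 'a process" where
  "simple_integral S X t \<omega> =
     (\<Sum>i<steps S. coef S i \<omega> * (X (min t (time S (Suc i) \<omega>)) \<omega> - X (min t (time S i \<omega>)) \<omega>))"

text \<open>Convergence in probability, uniformly on compact time intervals. The outer measure agrees with
  \<open>emeasure M\<close> on measurable sets, in particular whenever the paths are one-sided continuous; it
  excludes that a non-measurable set is assigned measure 0.\<close>

definition converges_ucp :: "'a measure \<Rightarrow> (nat \<Rightarrow> 'a process) \<Rightarrow> 'a process \<Rightarrow> bool" where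
  "converges_ucp M Z L \<longleftrightarrow>
     (\<forall>t\<ge>0. \<forall>\<epsilon>>0.
        (\<lambda>k. outer_measure_of M {\<omega> \<in> space M. \<exists>s\<in>{0..t}. \<epsilon> < \<bar>Z k s \<omega> - L s \<omega>\<bar>})
          \<longlonglongrightarrow> 0)"

text \<open>The Ito integral of an adapted integrand with left-continuous paths with right limits, such as
  \<open>left_limit Z\<close> for a semimartingale \<open>Z\<close>: the extension by ucp-continuity of the integral of simple
  predictable processes. Simple predictable processes are ucp-dense in this class of integrands and
  the elementary integral with respect to a semimartingale is ucp-continuous, so the integral
  exists and is unique up to indistinguishability; \<open>ito_integral\<close> picks a version of it.\<close>

definition is_ito_integral ::
    "'a measure \<Rightarrow> (real \<Rightarrow> 'a measure) \<Rightarrow> 'a process \<Rightarrow> 'a process \<Rightarrow> 'a process \<Rightarrow> bool" where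
  "is_ito_integral M F H X J \<longleftrightarrow> cadlag_adapted M F J \<and>
     (\<exists>S. (\<forall>k. simple_predictable M F (S k)) \<and> converges_ucp M (\<lambda>k. simple_process (S k)) H) \<and>
     (\<forall>S. (\<forall>k. simple_predictable M F (S k)) \<and> converges_ucp M (\<lambda>k. simple_process (S k)) H
        \<longrightarrow> converges_ucp M (\<lambda>k. simple_integral (S k) X) J)"

definition ito_integral ::
    "'a measure \<Rightarrow> (real \<Rightarrow> 'a measure) \<Rightarrow> 'a process \<Rightarrow> 'a process \<Rightarrow> 'a process" where
  "ito_integral M F H X = (SOME J. is_ito_integral M F H X J)"

definition quadratic_covariation ::
    "'a measure \<Rightarrow> (real \<Rightarrow> 'a measure) \<Rightarrow> 'a process \<Rightarrow> 'a process \<Rightarrow> 'a process" where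
  "quadratic_covariation M F X Y t \<omega> = X t \<omega> * Y t \<omega> - X 0 \<omega> * Y 0 \<omega>
     - ito_integral M F (left_limit X) Y t \<omega> - ito_integral M F (left_limit Y) X t \<omega>"

subsection \<open>Convex combinations and iterated limits\<close>

definition process_convex_hull :: "'a measure \<Rightarrow> 'a process set \<Rightarrow> 'a process set" where
  "process_convex_hull M \<A> = {W. \<exists>k (c :: nat \<Rightarrow> real) Z.
     (\<forall>i<k. 0 \<le> c i \<and> Z i \<in> \<A>) \<and> (\<Sum>i<k. c i) = 1 \<and>
     indistinguishable M W (\<lambda>t \<omega>. \<Sum>i<k. c i * Z i t \<omega>)}"

text \<open>\<open>L\<close> is the process \<open>lim_{s \<down> \<cdot>, s \<in> \<rat>} lim_n Z^n_s\<close>; existence of all the limits is included.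
  Such an \<open>L\<close> is unique up to indistinguishability.\<close>

definition is_iterated_limit :: "'a measure \<Rightarrow> (nat \<Rightarrow> 'a process) \<Rightarrow> 'a process \<Rightarrow> bool" where
  "is_iterated_limit M Z L \<longleftrightarrow>
     (\<exists>\<zeta> :: 'a process.
        (\<forall>s\<in>\<rat>. 0 \<le> s \<longrightarrow> (AE \<omega> in M. (\<lambda>n. Z n s \<omega>) \<longlonglongrightarrow> \<zeta> s \<omega>)) \<and>
        (AE \<omega> in M. \<forall>t\<ge>0. ((\<lambda>s. \<zeta> s \<omega>) \<longlongrightarrow> L t \<omega>) (at t within (\<rat> \<inter> {t<..}))))"

end

theory Submission
  imports Defs
begin

text \<open>
  Deterministic processes suffice. Let \<open>Y\<close> jump by 1 at time 1, and let \<open>X n\<close> jump by 1 at time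
  \<open>1 - 1 / (n + 2)\<close>. The jumps of the \<open>X n\<close> accumulate at 1 strictly from the left, so that
  \<open>Y\<^sub>-\<close> vanishes at each of them and \<open>X n\<close> and \<open>Y\<close> have no common jump, while \<open>X n\<^sub>-\<close> is already
  1 at time 1. Hence \<open>\<integral> Y\<^sub>- dX n = 0 = \<integral> Y\<^sub>- dY\<close>, but \<open>[X n, Y] = 0\<close> differs from
  \<open>[Y, Y] = Y\<close> and \<open>\<integral> X n\<^sub>- dY = Y\<close> differs from \<open>\<integral> Y\<^sub>- dY = 0\<close>. Convex combinations of the
  \<open>X n\<close> behave in the same way.
\<close>

subsection \<open>Step functions\<close>

text \<open>The jump times \<open>a i\<close> may repeat and come in any order, so that a convex
  combination of one-jump paths has this form as it stands.\<close>

definition step_fun :: "nat \<Rightarrow> (nat \<Rightarrow> real) \<Rightarrow> (nat \<Rightarrow> real) \<Rightarrow> real \<Rightarrow> real" where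
  "step_fun k c a t = (\<Sum>i<k. c i * indicator {a i..} t)"

text \<open>This is the left-limit path of \<open>step_fun k c a\<close>: a jump at
  \<open>a i\<close> is visible only strictly after \<open>a i\<close>.\<close>

definition step_fun_left :: "nat \<Rightarrow> (nat \<Rightarrow> real) \<Rightarrow> (nat \<Rightarrow> real) \<Rightarrow> real \<Rightarrow> real" where
  "step_fun_left k c a t = (\<Sum>i<k. c i * indicator {a i<..} t)"

lemma tendsto_indicator_atLeast_at_right:
  "((\<lambda>s. indicator {a..} s :: real) \<longlongrightarrow> indicator {a..} t) (at_right (t::real))"
proof (rule tendsto_eventually)
  show "\<forall>\<^sub>F s in at_right t. (indicator {a..} s :: real) = indicator {a..} t"
  proof (cases "a \<le> t")
    case True
    have "\<forall>\<^sub>F s in at_right t. t < s" by (simp add: eventually_at_filter)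
    then show ?thesis by eventually_elim (use True in \<open>auto simp: indicator_def\<close>)
  next
    case False
    then have "\<forall>\<^sub>F s in at_right t. s < a" by (intro eventually_at_rightI[of t a]) auto
    then show ?thesis by eventually_elim (use False in \<open>auto simp: indicator_def\<close>)
  qed
qed

lemma tendsto_indicator_atLeast_at_left:
  "((\<lambda>s. indicator {a..} s :: real) \<longlongrightarrow> indicator {a<..} t) (at_left (t::real))"
proof (rule tendsto_eventually)
  show "\<forall>\<^sub>F s in at_left t. (indicator {a..} s :: real) = indicator {a<..} t"
  proof (cases "a < t")
    case True
    then have "\<forall>\<^sub>F s in at_left t. a < s" by (intro eventually_at_leftI[of a t]) auto
    then show ?thesis by eventually_elim (use True in \<open>auto simp: indicator_def\<close>)
  next
    case False
    have "\<forall>\<^sub>F s in at_left t. s < t" by (simp add: eventually_at_filter)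
    then show ?thesis by eventually_elim (use False in \<open>auto simp: indicator_def\<close>)
  qed
qed

lemma step_fun_tendsto_at_right: "(step_fun k c a \<longlongrightarrow> step_fun k c a t) (at_right t)"
  unfolding step_fun_def by (intro tendsto_intros tendsto_indicator_atLeast_at_right)

lemma step_fun_tendsto_at_left: "(step_fun k c a \<longlongrightarrow> step_fun_left k c a t) (at_left t)"
  unfolding step_fun_def step_fun_left_def
  by (intro tendsto_intros tendsto_indicator_atLeast_at_left)

lemma cadlag_step_fun: "cadlag (step_fun k c a)"
  unfolding cadlag_def using step_fun_tendsto_at_right step_fun_tendsto_at_left by blast

lemma step_fun_eq_0: "(\<And>i. i < k \<Longrightarrow> t < a i) \<Longrightarrow> step_fun k c a t = 0"
  unfolding step_fun_def by (intro sum.neutral) (auto simp: not_le)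

lemma step_fun_eq_sum: "(\<And>i. i < k \<Longrightarrow> a i \<le> t) \<Longrightarrow> step_fun k c a t = (\<Sum>i<k. c i)"
  unfolding step_fun_def by (intro sum.cong) auto

lemma step_fun_left_eq_0: "(\<And>i. i < k \<Longrightarrow> t \<le> a i) \<Longrightarrow> step_fun_left k c a t = 0"
  unfolding step_fun_left_def by (intro sum.neutral) (auto simp: not_less)

lemma step_fun_left_eq_sum: "(\<And>i. i < k \<Longrightarrow> a i < t) \<Longrightarrow> step_fun_left k c a t = (\<Sum>i<k. c i)"
  unfolding step_fun_left_def by (intro sum.cong) auto

text \<open>For \<open>t > 0\<close> the left limit sees only times in \<open>(0, t)\<close>, where
  \<open>X\<close> is known. At time 0 it is \<open>X 0\<close> by convention, and strictly positive
  jump times make both step paths vanish there.\<close>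

lemma left_limit_step_fun:
  assumes X: "\<forall>t\<ge>0. X t \<omega> = step_fun k c a t" and a: "\<And>i. i < k \<Longrightarrow> 0 < a i" and t: "0 \<le> t"
  shows "left_limit X t \<omega> = step_fun_left k c a t"
proof (cases "t = 0")
  case True
  have "step_fun k c a 0 = 0" "step_fun_left k c a 0 = 0"
    using a by (auto intro!: step_fun_eq_0 step_fun_left_eq_0 less_imp_le)
  then show ?thesis using X True by (simp add: left_limit_def)
next
  case False
  then have t: "0 < t" using t by simp
  then have "\<forall>\<^sub>F s in at_left t. step_fun k c a s = X s \<omega>"
    by (intro eventually_at_leftI[of 0 t]) (use X in auto)
  then have "((\<lambda>s. X s \<omega>) \<longlongrightarrow> step_fun_left k c a t) (at_left t)"
    by (rule Lim_transform_eventually[OF step_fun_tendsto_at_left])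
  then have "Lim (at_left t) (\<lambda>s. X s \<omega>) = step_fun_left k c a t"
    by (intro tendsto_Lim) auto
  then show ?thesis using t by (simp add: left_limit_def)
qed

section \<open>Variation of monotone and one-jump paths\<close>

lemma path_variation_le_1:
  assumes "\<And>s t. s \<le> t \<Longrightarrow> f s \<le> f t" and "\<And>t. 0 \<le> f t \<and> f t \<le> 1"
  shows "path_variation f t \<le> 1"
  unfolding path_variation_def
proof (rule SUP_least, clarify)
  fix n :: nat and p :: "nat \<Rightarrow> real" assume p: "mono p"
  have "(\<Sum>i<n. ennreal \<bar>f (p (Suc i)) - f (p i)\<bar>) = (\<Sum>i<n. ennreal (f (p (Suc i)) - f (p i)))"
    using assms(1) monoD[OF p] by (intro sum.cong refl arg_cong[of _ _ ennreal] abs_of_nonneg) simp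
  also have "\<dots> = ennreal (\<Sum>i<n. f (p (Suc i)) - f (p i))"
    using assms(1) monoD[OF p] by (intro sum_ennreal) simp
  also have "(\<Sum>i<n. f (p (Suc i)) - f (p i)) = f (p n) - f (p 0)"
    by (rule sum_lessThan_telescope)
  also have "ennreal \<dots> \<le> 1"
    using assms(2)[of "p n"] assms(2)[of "p 0"] by (intro ennreal_le_1[THEN iffD2]) linarith
  finally show "(\<Sum>i<n. ennreal \<bar>f (p (Suc i)) - f (p i)\<bar>) \<le> 1" .
qed

lemma path_variation_indicator_le_1: "path_variation (indicator {a..}) t \<le> 1"
  by (rule path_variation_le_1) (auto simp: indicator_def)

lemma path_variation_indicator:
  assumes "0 < a" "a \<le> t"
  shows "path_variation (indicator {a..}) t = 1"
proof (rule antisym[OF path_variation_indicator_le_1])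
  \<comment> \<open>The single interval from 0 to \<open>a\<close> already captures the whole jump;
    staying at \<open>a\<close> afterwards gives an infinite nondecreasing sequence.\<close>
  define p where "p i = (if i = 0 then 0 else a)" for i :: nat
  have p: "(1, p) \<in> {(n :: nat, p :: nat \<Rightarrow> real). mono p \<and> range p \<subseteq> {0..t}}"
    using assms by (auto simp: p_def mono_def)
  have "(1 :: ennreal) = (\<Sum>i<1. ennreal \<bar>indicator {a..} (p (Suc i)) - indicator {a..} (p i)\<bar>)"
    using assms by (simp add: p_def)
  also have "\<dots> \<le> path_variation (indicator {a..}) t"
    unfolding path_variation_def by (rule SUP_upper2[OF p]) simp
  finally show "1 \<le> path_variation (indicator {a..}) t" .
qed

lemma total_variation_indicator:
  assumes "0 < a"
  shows "total_variation (indicator {a..}) = 1"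
proof -
  have "\<forall>\<^sub>F t in at_top. path_variation (indicator {a..}) t = 1"
    using eventually_ge_at_top[of a] by eventually_elim (rule path_variation_indicator[OF assms])
  then show ?thesis
    unfolding total_variation_def by (intro tendsto_Lim tendsto_eventually) auto
qed

text \<open>A step path moves only at its jumps, so the integral collects \<open>c i\<close> times
  the integrand at \<open>a i\<close>. Exchanging two finite sums turns the sum over the intervals
  of the integrand into a sum over jumps.\<close>

lemma simple_integral_step_fun:
  assumes X: "\<forall>t\<ge>0. X t \<omega> = step_fun k c a t"
    and a: "\<And>i. i < k \<Longrightarrow> 0 < a i"
    and nonneg: "\<And>j. j \<le> steps S \<Longrightarrow> 0 \<le> time S j \<omega>"
    and incr: "\<And>j. j < steps S \<Longrightarrow> time S j \<omega> \<le> time S (Suc j) \<omega>"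
    and t: "0 \<le> t"
  shows "simple_integral S X t \<omega> = step_fun k (\<lambda>i. c i * simple_process S (a i) \<omega>) a t"
proof -
  let ?T = "\<lambda>j. time S j \<omega>" and ?h = "\<lambda>j. coef S j \<omega>"
  have X': "X (min t (?T j)) \<omega> = step_fun k c a (min t (?T j))" if "j \<le> steps S" for j
    using X nonneg[OF that] t by simp
  \<comment> \<open>A unit jump at \<open>x\<close> enters the increment stopped at \<open>t\<close>
    exactly when it has occurred by \<open>t\<close> and lies in the same half-open interval as in
    \<open>simple_process\<close>.\<close>
  have jump: "indicator {x..} (min t (?T (Suc j))) - indicator {x..} (min t (?T j))
      = (indicator {x..} t * indicator {?T j<..?T (Suc j)} x :: real)" if "j < steps S" for x j
    using incr[OF that] by (auto simp: indicator_def min_def)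
  have "simple_integral S X t \<omega>
      = (\<Sum>j<steps S. ?h j * (\<Sum>i<k. c i * (indicator {a i..} t * indicator {?T j<..?T (Suc j)} (a i))))"
    unfolding simple_integral_def
    by (intro sum.cong refl)
      (simp add: X' step_fun_def jump[symmetric] right_diff_distrib sum_subtractf)
  also have "\<dots> = (\<Sum>i<k. \<Sum>j<steps S. c i * (?h j * indicator {?T j<..?T (Suc j)} (a i)) * indicator {a i..} t)"
    unfolding sum_distrib_left by (subst sum.swap) (simp only: ac_simps)
  also have "\<dots> = (\<Sum>i<k. c i * simple_process S (a i) \<omega> * indicator {a i..} t)"
  proof (intro sum.cong refl)
    fix i assume "i \<in> {..<k}"
    \<comment> \<open>The initial value of the integrand, which \<open>simple_integral\<close>
      omits, lives at time 0 only, and no jump occurs there.\<close>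
    then have "indicator {0} (a i) = (0 :: real)" using a by force
    then show "(\<Sum>j<steps S. c i * (?h j * indicator {?T j<..?T (Suc j)} (a i)) * indicator {a i..} t)
        = c i * simple_process S (a i) \<omega> * indicator {a i..} t"
      unfolding simple_process_def
      by (simp only: mult_zero_right add_0 sum_distrib_left sum_distrib_right)
  qed
  finally show ?thesis by (simp add: step_fun_def)
qed

subsection \<open>Uniqueness of ucp limits and of the integral\<close>

text \<open>Measurable covers of the same measure reduce this to subadditivity of
  \<open>emeasure\<close>. Outer measures appear because the deviation sets in
  \<open>converges_ucp\<close> may fail to be measurable.\<close>

lemma outer_measure_of_subadditive:
  assumes "A \<subseteq> space M" "B \<subseteq> space M"
  shows "outer_measure_of M (A \<union> B) \<le> outer_measure_of M A + outer_measure_of M B"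
proof -
  obtain A' where A': "A' \<in> sets M" "A \<subseteq> A'" "outer_measure_of M A = emeasure M A'"
    using outer_measure_of_attain[OF assms(1)] by auto
  obtain B' where B': "B' \<in> sets M" "B \<subseteq> B'" "outer_measure_of M B = emeasure M B'"
    using outer_measure_of_attain[OF assms(2)] by auto
  have "outer_measure_of M (A \<union> B) \<le> outer_measure_of M (A' \<union> B')"
    using A' B' by (intro outer_measure_of_mono) auto
  also have "\<dots> \<le> emeasure M A' + emeasure M B'"
    using A' B' by (simp add: emeasure_subadditive)
  finally show ?thesis using A' B' by simp
qed

lemma AE_not_in_if_outer_measure_of_eq_0:
  assumes "A \<subseteq> space M" "outer_measure_of M A = 0"
  shows "AE \<omega> in M. \<omega> \<notin> A"
proof -
  obtain A' where "A' \<in> sets M" "A \<subseteq> A'" "outer_measure_of M A = emeasure M A'"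
    using outer_measure_of_attain[OF assms(1)] by auto
  then have "A' \<in> null_sets M" "A \<subseteq> A'" using assms(2) by auto
  then show ?thesis by (auto dest!: AE_not_in elim: eventually_mono)
qed

lemma outer_measure_of_eq_0_if_AE:
  assumes "AE \<omega> in M. \<omega> \<notin> A" "A \<subseteq> space M"
  shows "outer_measure_of M A = 0"
proof -
  obtain N where N: "N \<in> null_sets M" "{\<omega> \<in> space M. \<not> \<omega> \<notin> A} \<subseteq> N"
    using assms(1) unfolding eventually_ae_filter by blast
  then have "outer_measure_of M A \<le> outer_measure_of M N"
    using assms(2) by (intro outer_measure_of_mono) auto
  with N show ?thesis by (simp add: null_sets_def)
qed

text \<open>Where \<open>J\<close> and \<open>K\<close> differ by more than \<open>e\<close>, every
  \<open>Z n\<close> differs from one of them by more than \<open>e / 2\<close>, and the outer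
  measures of both such sets tend to 0.\<close>

lemma converges_ucp_unique:
  assumes J: "converges_ucp M Z J" and K: "converges_ucp M Z K"
  shows "indistinguishable M J K"
proof -
  have "AE \<omega> in M. \<omega> \<notin> {\<omega> \<in> space M. \<exists>s\<in>{0..t}. e < \<bar>J s \<omega> - K s \<omega>\<bar>}"
    if "0 \<le> t" "0 < e" for t e
  proof (rule AE_not_in_if_outer_measure_of_eq_0)
    define D where "D V U d = {\<omega> \<in> space M. \<exists>s\<in>{0..t}. d < \<bar>V s \<omega> - U s \<omega>\<bar>}" for V U :: "'a process" and d
    have "outer_measure_of M (D J K e)
        \<le> outer_measure_of M (D (Z n) J (e / 2)) + outer_measure_of M (D (Z n) K (e / 2))" for n
    proof -
      have "\<omega> \<in> D (Z n) J (e / 2) \<union> D (Z n) K (e / 2)" if \<omega>: "\<omega> \<in> D J K e" for \<omega>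
      proof -
        obtain s where s: "s \<in> {0..t}" "e < \<bar>J s \<omega> - K s \<omega>\<bar>" and sp: "\<omega> \<in> space M"
          using \<omega> by (auto simp: D_def)
        have "e / 2 < \<bar>Z n s \<omega> - J s \<omega>\<bar> \<or> e / 2 < \<bar>Z n s \<omega> - K s \<omega>\<bar>"
          using s(2) by linarith
        then show ?thesis using s(1) sp by (auto simp: D_def)
      qed
      then have "outer_measure_of M (D J K e)
          \<le> outer_measure_of M (D (Z n) J (e / 2) \<union> D (Z n) K (e / 2))"
        by (intro outer_measure_of_mono) blast
      also have "\<dots> \<le> outer_measure_of M (D (Z n) J (e / 2)) + outer_measure_of M (D (Z n) K (e / 2))"
        by (rule outer_measure_of_subadditive) (auto simp: D_def)
      finally show ?thesis .
    qed
    moreover have "(\<lambda>n. outer_measure_of M (D (Z n) J (e / 2)) + outer_measure_of M (D (Z n) K (e / 2)))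
        \<longlonglongrightarrow> 0 + 0"
      unfolding D_def using J K that half_gt_zero unfolding converges_ucp_def
      by (intro tendsto_add) blast+
    ultimately have "outer_measure_of M (D J K e) \<le> 0 + 0"
      by (intro LIMSEQ_le_const) auto
    then show "outer_measure_of M {\<omega> \<in> space M. \<exists>s\<in>{0..t}. e < \<bar>J s \<omega> - K s \<omega>\<bar>} = 0"
      by (simp add: D_def)
  qed auto
  \<comment> \<open>Countably many horizons and thresholds suffice: every \<open>t\<close> is at
    most some \<open>n\<close>, and every nonzero difference exceeds some
    \<open>inverse (real (Suc m))\<close>.\<close>
  then have "AE \<omega> in M. \<forall>n m :: nat.
      \<omega> \<notin> {\<omega> \<in> space M. \<exists>s\<in>{0..real n}. inverse (real (Suc m)) < \<bar>J s \<omega> - K s \<omega>\<bar>}"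
    by (simp add: AE_all_countable)
  then show ?thesis
    unfolding indistinguishable_def using AE_space
  proof eventually_elim
    case (elim \<omega>)
    note sp = elim(2) and elim = elim(1)
    show ?case
    proof (intro allI impI, rule ccontr)
      fix t :: real assume t: "0 \<le> t" and ne: "J t \<omega> \<noteq> K t \<omega>"
      obtain n :: nat where "t \<le> real n" using real_arch_simple by blast
      moreover obtain m where "inverse (real (Suc m)) < \<bar>J t \<omega> - K t \<omega>\<bar>"
        using reals_Archimedean[of "\<bar>J t \<omega> - K t \<omega>\<bar>"] ne by auto
      ultimately show False using elim[rule_format, of n m] sp t by auto
    qed
  qed
qed

text \<open>The chosen version satisfies the same specification as \<open>J\<close>. The
  specification provides an approximating sequence, along which the simple integrals converge to
  both processes, so ucp uniqueness applies.\<close>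

lemma indistinguishable_ito_integral:
  assumes "is_ito_integral M F H X J"
  shows "indistinguishable M (ito_integral M F H X) J"
proof -
  have "is_ito_integral M F H X (ito_integral M F H X)"
    unfolding ito_integral_def by (rule someI[where P = "is_ito_integral M F H X", OF assms])
  then show ?thesis
    using assms converges_ucp_unique unfolding is_ito_integral_def by metis
qed

subsection \<open>Deterministic step processes\<close>

text \<open>Listing \<open>A\<close>, 0 and \<open>K\<close> in increasing order gives a grid whose
  open cells contain no point of \<open>A\<close>. Left-continuous step paths with jump times in
  \<open>A\<close> are then constant on the half-open cells of a simple integrand.\<close>

lemma finite_set_grid:
  fixes A :: "real set"
  assumes "finite A" "\<And>x. x \<in> A \<Longrightarrow> 0 \<le> x" "0 \<le> K"
  obtains n and T :: "nat \<Rightarrow> real" where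
    "T 0 = 0" "\<And>i. 0 \<le> T i" "mono T" "K \<le> T n" "\<And>x i. x \<in> A \<Longrightarrow> x \<le> T i \<or> T (Suc i) \<le> x"
proof -
  define B where "B = insert 0 (insert K A)"
  define xs where "xs = sorted_list_of_set B"
  \<comment> \<open>Capping the index repeats the last entry forever, so that \<open>T\<close> is
    monotone on all of \<open>nat\<close>.\<close>
  define T where "T i = xs ! min i (length xs - 1)" for i
  have fin: "finite B" and nonneg: "x \<in> B \<Longrightarrow> 0 \<le> x" for x
    using assms by (auto simp: B_def)
  have set: "set xs = B" and sorted: "sorted xs" using fin by (auto simp: xs_def)
  have len: "0 < length xs" using set by (auto simp: B_def)
  have idx: "\<exists>j<length xs. x = xs ! j" if "x \<in> B" for x
    using that set by (metis in_set_conv_nth)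
  have T_in: "T i \<in> B" for i
    unfolding T_def using len set by (metis nth_mem min_less_iff_disj diff_less zero_less_one)
  have mono: "mono T"
    unfolding T_def by (intro monoI sorted_nth_mono[OF sorted]) (use len in linarith)+
  have eq: "xs ! j = T j" if "j < length xs" for j
  proof -
    have "min j (length xs - 1) = j" using that by linarith
    then show ?thesis by (simp only: T_def)
  qed
  have onto: "\<exists>j. x = T j" if "x \<in> B" for x
    using idx[OF that] eq by metis
  obtain j where j: "0 = T j" using onto[of 0] by (auto simp: B_def)
  have "T 0 \<le> T j" using mono by (simp add: monoD)
  then have "T 0 = 0" using nonneg[OF T_in, of 0] j by simp
  moreover obtain n where "K = T n" using onto[of K] by (auto simp: B_def)
  moreover have "x \<le> T i \<or> T (Suc i) \<le> x" if "x \<in> A" for x i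
  proof -
    obtain j where "x = T j" using onto[of x] \<open>x \<in> A\<close> by (auto simp: B_def)
    then show ?thesis using monoD[OF mono, of j i] monoD[OF mono, of "Suc i" j] by linarith
  qed
  ultimately show thesis using that[of T n] mono nonneg[OF T_in] by auto
qed

context usual_filtered_prob_space
begin

section \<open>Semimartingale property and Ito integrals of step paths\<close>

lemma cadlag_adapted_step_fun: "cadlag_adapted M F (\<lambda>t \<omega>. step_fun k c a t)"
  by (simp add: cadlag_adapted_def cadlag_step_fun)

lemma real_cond_exp_zero: "AE \<omega> in M. real_cond_exp M (F s) (\<lambda>_. 0) \<omega> = 0"
proof -
  interpret finite_measure_subalgebra M "F s"
    by unfold_locales (rule subalgebra_F)
  show ?thesis by (rule real_cond_exp_F_meas) auto
qed

lemma local_martingale_zero: "local_martingale M F (\<lambda>t \<omega>. 0)"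
proof -
  have "filterlim (\<lambda>n. real n) at_top sequentially" by (rule filterlim_real_sequentially)
  moreover have "martingale M F (\<lambda>t \<omega>. 0)"
    by (simp add: martingale_def real_cond_exp_zero)
  ultimately show ?thesis
    unfolding local_martingale_def
    by (auto simp: cadlag_adapted_def cadlag_def stopping_time_const incseq_def
        intro!: exI[of _ "\<lambda>n \<omega>. real n"])
qed

text \<open>The path is its own finite variation part, with zero local martingale part;
  \<open>0 < a\<close> makes it start at 0, as the decomposition demands.\<close>

lemma semimartingale_indicator:
  assumes "0 < a"
  shows "semimartingale M F (\<lambda>t \<omega>. indicator {a..} t)"
proof -
  let ?X = "\<lambda>t (\<omega> :: 'a). indicator {a..} t :: real"
  have adapted: "cadlag_adapted M F ?X"
    using cadlag_adapted_step_fun[of 1 "\<lambda>_. 1" "\<lambda>_. a"] by (simp add: step_fun_def)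
  have "path_variation (indicator {a..}) t < \<infinity>" for t
    by (rule le_less_trans[OF path_variation_indicator_le_1]) simp
  then have "finite_variation_process M F ?X"
    using adapted by (simp add: finite_variation_process_def)
  then have "local_martingale M F (\<lambda>t \<omega>. 0) \<and> finite_variation_process M F ?X \<and>
      (AE \<omega> in M. 0 = (0 :: real) \<and> ?X 0 \<omega> = 0) \<and>
      indistinguishable M ?X (\<lambda>t \<omega>. ?X 0 \<omega> + 0 + ?X t \<omega>)"
    using assms local_martingale_zero by (simp add: indistinguishable_def)
  then show ?thesis
    unfolding semimartingale_def
    using adapted by fast
qed

text \<open>Up to any horizon the path is itself a simple predictable process, with all jump times
  among the grid points. Hence the \<open>n\<close>-th approximation is exact on
  \<open>[0, t]\<close>, up to a null set, once \<open>n \<ge> t\<close>.\<close>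

lemma step_fun_left_approximable:
  assumes a: "\<And>i. i < k \<Longrightarrow> 0 < a i"
    and H: "indistinguishable M H (\<lambda>t \<omega>. step_fun_left k c a t)"
  shows "\<exists>S. (\<forall>n. simple_predictable M F (S n)) \<and> converges_ucp M (\<lambda>n. simple_process (S n)) H"
proof -
  let ?h = "step_fun_left k c a"
  have "\<exists>S. simple_predictable M F S \<and> (\<forall>t\<in>{0..real K}. \<forall>\<omega>. simple_process S t \<omega> = ?h t)" for K
  proof -
    obtain n T where T: "T 0 = 0" "\<And>i. 0 \<le> T i" "mono T" "real K \<le> T n"
      and grid: "\<And>x i. x \<in> a ` {..<k} \<Longrightarrow> x \<le> T i \<or> T (Suc i) \<le> x"
      by (rule finite_set_grid[of "a ` {..<k}" "real K"]) (auto dest: a)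
    define S :: "'a simple_integrand" where
      \<comment> \<open>The coefficient is taken at the right end of the cell
        \<open>(T i, T (Suc i)]\<close>, on which the path is constant; at the left end the value
        may differ, since a jump at \<open>T i\<close> shows only afterwards.\<close>
      "S = \<lparr>init = \<lambda>_. 0, steps = n, time = \<lambda>i _. T i, coef = \<lambda>i _. ?h (T (Suc i))\<rparr>"
    have "simple_predictable M F S"
      using T monoD[OF T(3)] by (simp add: simple_predictable_def S_def stopping_time_const)
    moreover have "simple_process S t \<omega> = ?h t" if t: "t \<in> {0..real K}" for t \<omega>
    proof -
      have const: "?h (T (Suc i)) * indicator {T i<..T (Suc i)} t = ?h t * indicator {T i<..T (Suc i)} t" for i
      proof (cases "t \<in> {T i<..T (Suc i)}")
        case True
        have "(indicator {a j<..} (T (Suc i)) :: real) = indicator {a j<..} t" if "j < k" for j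
          using grid[of "a j" i] that True by (auto simp: indicator_def)
        then show ?thesis by (simp add: step_fun_left_def)
      qed simp
      \<comment> \<open>The cells tile \<open>(0, T m]\<close>, so exactly one term survives at each
        time there.\<close>
      have cover: "(\<Sum>i<m. indicator {T i<..T (Suc i)} t) = (indicator {0<..T m} t :: real)" for m
      proof (induction m)
        case (Suc m)
        have "0 \<le> T m" "T m \<le> T (Suc m)" using T(2) monoD[OF T(3)] by simp_all
        then show ?case by (simp only: sum.lessThan_Suc Suc) (auto simp: indicator_def)
      qed (simp add: T(1))
      have "simple_process S t \<omega> = ?h t * indicator {0<..T n} t"
        by (simp add: simple_process_def S_def const cover flip: sum_distrib_left)
      moreover have "?h 0 = 0" using a by (intro step_fun_left_eq_0) (simp add: less_imp_le)
      ultimately show ?thesis using t T(4) by (cases "t = 0") auto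
    qed
    ultimately show ?thesis by blast
  qed
  then obtain S where S: "\<And>K. simple_predictable M F (S K)"
    and S_eq: "\<And>K t \<omega>. t \<in> {0..real K} \<Longrightarrow> simple_process (S K) t \<omega> = ?h t"
    by metis
  have "converges_ucp M (\<lambda>n. simple_process (S n)) H"
    unfolding converges_ucp_def
  proof (intro allI impI tendsto_eventually)
    fix t e :: real assume t: "0 \<le> t" and e: "0 < e"
    obtain K :: nat where K: "t \<le> real K" using real_arch_simple by blast
    show "\<forall>\<^sub>F n in sequentially.
        outer_measure_of M {\<omega> \<in> space M. \<exists>s\<in>{0..t}. e < \<bar>simple_process (S n) s \<omega> - H s \<omega>\<bar>} = 0"
      using eventually_ge_at_top[of K]
    proof eventually_elim
      case (elim n)
      then have n: "t \<le> real n" using K by simp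
      show ?case
      proof (rule outer_measure_of_eq_0_if_AE)
        show "AE \<omega> in M. \<omega> \<notin> {\<omega> \<in> space M. \<exists>s\<in>{0..t}. e < \<bar>simple_process (S n) s \<omega> - H s \<omega>\<bar>}"
          using H unfolding indistinguishable_def
          by eventually_elim (use n e S_eq in auto)
      qed auto
    qed
  qed
  with S show ?thesis by blast
qed

text \<open>The integral depends on the integrand only through its values at finitely many jump
  times. Its error up to time \<open>t\<close> is thus at most the sum of the
  \<open>\<bar>c i\<bar>\<close> times the uniform error of the integrand on
  \<open>[0, t]\<close>.\<close>

lemma simple_integral_converges_ucp:
  assumes a: "\<And>i. i < k \<Longrightarrow> 0 < a i"
    and X: "indistinguishable M X (\<lambda>t \<omega>. step_fun k c a t)"
    and H: "indistinguishable M H (\<lambda>t \<omega>. h t)"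
    and S: "\<And>n. simple_predictable M F (S n)" "converges_ucp M (\<lambda>n. simple_process (S n)) H"
  shows "converges_ucp M (\<lambda>n. simple_integral (S n) X) (\<lambda>t \<omega>. step_fun k (\<lambda>i. c i * h (a i)) a t)"
  unfolding converges_ucp_def
proof (intro allI impI)
  fix t e :: real assume t: "0 \<le> t" and e: "0 < e"
  define J where "J = step_fun k (\<lambda>i. c i * h (a i)) a"
  \<comment> \<open>The summand 1 keeps \<open>C\<close> positive even if all \<open>c i\<close>
    vanish; the error bound becomes \<open>(C - 1) * (e / C)\<close>, which is at most
    \<open>e\<close>.\<close>
  define C where "C = 1 + (\<Sum>i<k. \<bar>c i\<bar>)"
  define D where "D n = {\<omega> \<in> space M. \<exists>s\<in>{0..t}. e < \<bar>simple_integral (S n) X s \<omega> - J s\<bar>}" for n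
  define E where "E n = {\<omega> \<in> space M. \<exists>s\<in>{0..t}. e / C < \<bar>simple_process (S n) s \<omega> - H s \<omega>\<bar>}" for n
  have C: "1 \<le> C" by (simp add: C_def sum_nonneg)
  have "outer_measure_of M (D n) \<le> outer_measure_of M (E n)" for n
  proof -
    have "AE \<omega> in M. \<omega> \<in> D n \<longrightarrow> \<omega> \<in> E n"
      using X H AE_space unfolding indistinguishable_def
    proof eventually_elim
      case (elim \<omega>)
      show ?case
      proof (rule impI, rule ccontr)
        assume D: "\<omega> \<in> D n" and E: "\<omega> \<notin> E n"
        from D obtain s where s: "0 \<le> s" "s \<le> t" "e < \<bar>simple_integral (S n) X s \<omega> - J s\<bar>"
          by (auto simp: D_def)
        let ?d = "\<lambda>i. simple_process (S n) (a i) \<omega> - h (a i)"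
        have "simple_integral (S n) X s \<omega> = step_fun k (\<lambda>i. c i * simple_process (S n) (a i) \<omega>) a s"
          by (rule simple_integral_step_fun)
            (use elim a s S(1)[of n] in \<open>auto simp: simple_predictable_def\<close>)
        then have "simple_integral (S n) X s \<omega> - J s = (\<Sum>i<k. c i * (?d i * indicator {a i..} s))"
          by (simp only: J_def step_fun_def sum_subtractf[symmetric] left_diff_distrib
                right_diff_distrib mult.assoc)
        also have "\<bar>\<dots>\<bar> \<le> (\<Sum>i<k. \<bar>c i\<bar> * (e / C))"
        proof (rule order_trans[OF sum_abs sum_mono])
          fix i assume i: "i \<in> {..<k}"
          \<comment> \<open>A jump after \<open>s\<close> contributes nothing; any other lies in
            \<open>[0, t]\<close>, where \<open>\<omega> \<notin> E n\<close> bounds the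
            error.\<close>
          have "\<bar>?d i * indicator {a i..} s\<bar> \<le> e / C"
          proof (cases "a i \<le> s")
            case True
            have "0 < a i" using a i by simp
            then have "\<bar>simple_process (S n) (a i) \<omega> - H (a i) \<omega>\<bar> \<le> e / C"
              using E elim(3) True s by (force simp: E_def not_less)
            moreover have "H (a i) \<omega> = h (a i)" using elim(2) \<open>0 < a i\<close> by simp
            ultimately show ?thesis using True by simp
          qed (use C e in simp)
          then show "\<bar>c i * (?d i * indicator {a i..} s)\<bar> \<le> \<bar>c i\<bar> * (e / C)"
            unfolding abs_mult[of "c i"] by (rule mult_left_mono) simp
        qed
        also have "\<dots> = (C - 1) * (e / C)" by (simp only: C_def add_diff_cancel_left' sum_distrib_right)
        also have "\<dots> \<le> e" using C e by (simp add: field_simps)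
        finally show False using s(3) by simp
      qed
    qed
    \<comment> \<open>The inclusion of \<open>D n\<close> in \<open>E n\<close> is known only almost
      surely; the exceptional part has outer measure 0 and is absorbed by subadditivity.\<close>
    then have "outer_measure_of M (D n - E n) = 0"
      by (intro outer_measure_of_eq_0_if_AE) (auto simp: D_def elim: eventually_mono)
    moreover have "outer_measure_of M (D n) \<le> outer_measure_of M (E n \<union> (D n - E n))"
      by (rule outer_measure_of_mono) auto
    moreover have "\<dots> \<le> outer_measure_of M (E n) + outer_measure_of M (D n - E n)"
      by (rule outer_measure_of_subadditive) (auto simp: D_def E_def)
    ultimately show ?thesis by simp
  qed
  then have le: "\<forall>\<^sub>F n in sequentially. outer_measure_of M (D n) \<le> outer_measure_of M (E n)"
    by (intro always_eventually allI)
  have lim: "(\<lambda>n. outer_measure_of M (E n)) \<longlonglongrightarrow> 0"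
  proof -
    have "0 < e / C" using C e by simp
    then show ?thesis unfolding E_def using S(2) t unfolding converges_ucp_def by blast
  qed
  have "(\<lambda>n. outer_measure_of M (D n)) \<longlonglongrightarrow> 0"
    by (rule tendsto_sandwich[OF _ le tendsto_const lim]) simp
  then show "(\<lambda>n. outer_measure_of M {\<omega> \<in> space M. \<exists>s\<in>{0..t}.
      e < \<bar>simple_integral (S n) X s \<omega> - step_fun k (\<lambda>i. c i * h (a i)) a s\<bar>}) \<longlonglongrightarrow> 0"
    by (simp add: D_def J_def)
qed

text \<open>This is the Stieltjes formula: each jump of \<open>X\<close> is weighted by the left
  limit of \<open>Z\<close> at the jump time. Existence of an approximating sequence and convergence
  along every such sequence both have to be checked.\<close>

lemma ito_integral_step_fun:
  assumes Z: "indistinguishable M Z (\<lambda>t \<omega>. step_fun l d b t)" and b: "\<And>i. i < l \<Longrightarrow> 0 < b i"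
    and X: "indistinguishable M X (\<lambda>t \<omega>. step_fun k c a t)" and a: "\<And>i. i < k \<Longrightarrow> 0 < a i"
  shows "indistinguishable M (ito_integral M F (left_limit Z) X)
    (\<lambda>t \<omega>. step_fun k (\<lambda>i. c i * step_fun_left l d b (a i)) a t)"
proof -
  have H: "indistinguishable M (left_limit Z) (\<lambda>t \<omega>. step_fun_left l d b t)"
    using Z unfolding indistinguishable_def
  proof eventually_elim
    case (elim \<omega>)
    show ?case by (intro allI impI left_limit_step_fun[where X = Z] elim b)
  qed
  have "is_ito_integral M F (left_limit Z) X
      (\<lambda>t \<omega>. step_fun k (\<lambda>i. c i * step_fun_left l d b (a i)) a t)"
    unfolding is_ito_integral_def
  proof (intro conjI allI impI cadlag_adapted_step_fun)
    show "\<exists>S. (\<forall>n. simple_predictable M F (S n)) \<and>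
        converges_ucp M (\<lambda>n. simple_process (S n)) (left_limit Z)"
      using b H by (rule step_fun_left_approximable)
  next
    fix S assume "(\<forall>n. simple_predictable M F (S n)) \<and>
        converges_ucp M (\<lambda>n. simple_process (S n)) (left_limit Z)"
    then show "converges_ucp M (\<lambda>n. simple_integral (S n) X)
        (\<lambda>t \<omega>. step_fun k (\<lambda>i. c i * step_fun_left l d b (a i)) a t)"
      using a X H by (intro simple_integral_converges_ucp) auto
  qed
  then show ?thesis by (rule indistinguishable_ito_integral)
qed

section \<open>Iterated limits and convex combinations\<close>

lemma is_iterated_limit_const:
  assumes Z: "\<And>n. indistinguishable M (Z n) (\<lambda>t \<omega>. f t)"
    and L: "indistinguishable M L (\<lambda>t \<omega>. f t)"
    and f: "\<And>t. 0 \<le> t \<Longrightarrow> (f \<longlongrightarrow> f t) (at_right t)"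
  shows "is_iterated_limit M Z L"
  unfolding is_iterated_limit_def
proof (intro exI[of _ "\<lambda>t \<omega>. f t"] conjI ballI impI)
  have "AE \<omega> in M. \<forall>n. \<forall>t\<ge>0. Z n t \<omega> = f t"
    using Z by (simp add: AE_all_countable indistinguishable_def)
  then show "AE \<omega> in M. (\<lambda>n. Z n s \<omega>) \<longlonglongrightarrow> f s" if "0 \<le> s" for s
    by eventually_elim (use that in simp)
  show "AE \<omega> in M. \<forall>t\<ge>0. (f \<longlongrightarrow> L t \<omega>) (at t within \<rat> \<inter> {t<..})"
    using L unfolding indistinguishable_def
  proof eventually_elim
    case (elim \<omega>)
    then show ?case using f by (auto intro: tendsto_within_subset)
  qed
qed

text \<open>Convex weights turn into jump sizes, so their total 1 becomes the value of the path once
  all jumps have occurred.\<close>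

lemma process_convex_hull_indicator:
  assumes W: "W \<in> process_convex_hull M {(\<lambda>t \<omega>. indicator {\<tau> m..} t) | m. n \<le> m}"
  obtains k c a where "indistinguishable M W (\<lambda>t \<omega>. step_fun k c a t)"
    "(\<Sum>i<k. c i) = 1" "\<And>i. i < k \<Longrightarrow> \<exists>m\<ge>n. a i = \<tau> m"
proof -
  obtain k c and Z :: "nat \<Rightarrow> 'a process" where Z: "\<forall>i<k. 0 \<le> c i \<and> Z i \<in> {(\<lambda>t \<omega>. indicator {\<tau> m..} t) | m. n \<le> m}"
    and c: "(\<Sum>i<k. c i) = 1" and W: "indistinguishable M W (\<lambda>t \<omega>. \<Sum>i<k. c i * Z i t \<omega>)"
    using W unfolding process_convex_hull_def by blast
  then have "\<forall>i\<in>{..<k}. \<exists>m. n \<le> m \<and> Z i = (\<lambda>t \<omega>. indicator {\<tau> m..} t)" by blast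
  then obtain \<mu> where \<mu>: "\<And>i. i < k \<Longrightarrow> n \<le> \<mu> i \<and> Z i = (\<lambda>t \<omega>. indicator {\<tau> (\<mu> i)..} t)"
    by (metis lessThan_iff)
  have "(\<Sum>i<k. c i * Z i t \<omega>) = step_fun k c (\<lambda>i. \<tau> (\<mu> i)) t" for t \<omega>
    unfolding step_fun_def by (intro sum.cong refl) (simp add: \<mu>)
  then have "indistinguishable M W (\<lambda>t \<omega>. step_fun k c (\<lambda>i. \<tau> (\<mu> i)) t)" using W by simp
  then show thesis using c by (rule that) (use \<mu> in blast)
qed

text \<open>Up to indistinguishability the integrals and covariations do not depend on
  \<open>n\<close>: the Stieltjes formula makes each of them 0 or \<open>y\<close>. That
  \<open>\<tau>\<close> tends to 1 enters in the convergence of \<open>W\<close> itself.\<close>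

lemma left_accumulating_jumps_limits:
  fixes \<tau> :: "nat \<Rightarrow> real"
  assumes \<tau>: "\<And>n. 0 < \<tau> n" "\<And>n. \<tau> n < 1" "\<tau> \<longlonglongrightarrow> 1"
    and W: "\<And>n. W n \<in> process_convex_hull M {(\<lambda>t \<omega>. indicator {\<tau> m..} t) | m. n \<le> m}"
  defines "Y \<equiv> (\<lambda>t \<omega>. indicator {1..} t) :: 'a process"
  shows "is_iterated_limit M W Y"
    and "is_iterated_limit M (\<lambda>n. ito_integral M F (left_limit Y) (W n)) (ito_integral M F (left_limit Y) Y)"
    and "\<exists>L. is_iterated_limit M (\<lambda>n. quadratic_covariation M F (W n) Y) L \<and>
      \<not> indistinguishable M L (quadratic_covariation M F Y Y)"
    and "\<exists>L. is_iterated_limit M (\<lambda>n. ito_integral M F (left_limit (W n)) Y) L \<and>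
      \<not> indistinguishable M L (ito_integral M F (left_limit Y) Y)"
proof -
  define y :: "real \<Rightarrow> real" where "y = step_fun 1 (\<lambda>_. 1) (\<lambda>_. 1)"
  have y: "y t = indicator {1..} t" for t by (simp add: y_def step_fun_def)
  have Y: "indistinguishable M Y (\<lambda>t \<omega>. step_fun 1 (\<lambda>_. 1) (\<lambda>_. 1) t)"
    by (simp add: Y_def step_fun_def indistinguishable_def)
  have Y_eq: "Y t \<omega> = y t" for t \<omega> by (simp add: Y_def y)
  have y_0: "y 0 = 0" and y_sq: "y t * y t = y t" for t by (simp_all add: y indicator_def)
  have y_right: "(y \<longlongrightarrow> y t) (at_right t)" for t
    unfolding y_def by (rule step_fun_tendsto_at_right)
  have "\<exists>k c a. indistinguishable M (W n) (\<lambda>t \<omega>. step_fun k c a t) \<and> (\<Sum>i<k. c i) = 1 \<and>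
      (\<forall>i<k. \<exists>m\<ge>n. a i = \<tau> m)" for n
    by (rule process_convex_hull_indicator[OF W[of n]]) blast
  then obtain k c a where W_eq: "\<And>n. indistinguishable M (W n) (\<lambda>t \<omega>. step_fun (k n) (c n) (a n) t)"
    and c: "\<And>n. (\<Sum>i<k n. c n i) = 1" and a_in: "\<And>n i. i < k n \<Longrightarrow> \<exists>m\<ge>n. a n i = \<tau> m"
    by metis
  have a: "0 < a n i" "a n i < 1" if "i < k n" for n i
    using a_in[OF that] \<tau> by auto
  have w_1: "step_fun (k n) (c n) (a n) t = 1" if "1 \<le> t" for n t
    using step_fun_eq_sum[of "k n" "a n" t "c n"] a(2) that c by force
  \<comment> \<open>All jumps of \<open>W n\<close> occur strictly before 1, so its left limit at
    the jump time of \<open>Y\<close> is already 1.\<close>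
  have w_left_1: "step_fun_left (k n) (c n) (a n) 1 = 1" for n
    using step_fun_left_eq_sum[of "k n" "a n" 1 "c n"] a(2) c by force
  \<comment> \<open>The left limit of \<open>Y\<close> vanishes up to and including time 1, hence at
    every jump time of \<open>W n\<close> and of \<open>Y\<close>.\<close>
  have y_left_0: "step_fun_left 1 (\<lambda>_. 1) (\<lambda>_. 1) t = 0" if "t \<le> 1" for t
    using that by (simp add: step_fun_left_def)
  \<comment> \<open>The product of \<open>W n\<close> and \<open>Y\<close> is \<open>Y\<close>; in
    the covariation it cancels against the integral of the left limit of \<open>W n\<close>.\<close>
  have cov: "step_fun (k n) (c n) (a n) t * y t = y t" for n t
    using w_1 by (cases "1 \<le> t") (simp_all add: y)

  have YY: "indistinguishable M (ito_integral M F (left_limit Y) Y) (\<lambda>t \<omega>. 0)"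
    using ito_integral_step_fun[OF Y _ Y] by (simp add: step_fun_def step_fun_left_def)
  have YW: "indistinguishable M (ito_integral M F (left_limit Y) (W n)) (\<lambda>t \<omega>. 0)" for n
  proof -
    have "step_fun (k n) (\<lambda>i. c n i * step_fun_left 1 (\<lambda>_. 1) (\<lambda>_. 1) (a n i)) (a n) t = 0" for t
      unfolding step_fun_def using a(2) y_left_0 by (intro sum.neutral) (simp add: less_imp_le)
    then show ?thesis using ito_integral_step_fun[OF Y _ W_eq[of n]] a(1) by simp
  qed
  have WY: "indistinguishable M (ito_integral M F (left_limit (W n)) Y) (\<lambda>t \<omega>. y t)" for n
    using ito_integral_step_fun[OF W_eq[of n] _ Y] a(1) by (simp add: w_left_1 y_def)
  have qYY: "indistinguishable M (quadratic_covariation M F Y Y) (\<lambda>t \<omega>. y t)"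
    using YY unfolding indistinguishable_def
    by eventually_elim (simp add: quadratic_covariation_def Y_eq y_0 y_sq)
  have qWY: "indistinguishable M (quadratic_covariation M F (W n) Y) (\<lambda>t \<omega>. 0)" for n
    using YW[of n] WY[of n] W_eq[of n] unfolding indistinguishable_def
  proof eventually_elim
    case (elim \<omega>)
    then show ?case
      using cov[of n] by (simp add: quadratic_covariation_def Y_eq y_0)
  qed
  \<comment> \<open>A nonrandom statement holds almost surely on a probability space only if it is
    true, and these fail at time 1.\<close>
  have ne: "\<not> (AE \<omega> in M. \<forall>t\<ge>0. y t = 0)" "\<not> (AE \<omega> in M. \<forall>t\<ge>0. 0 = y t)"
    by (auto simp: y intro!: exI[of _ 1])

  show "is_iterated_limit M W Y"
    unfolding is_iterated_limit_def
  proof (intro exI[of _ "\<lambda>t \<omega>. y t"] conjI ballI impI)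
    have "AE \<omega> in M. \<forall>n. \<forall>t\<ge>0. W n t \<omega> = step_fun (k n) (c n) (a n) t"
      using W_eq by (simp add: AE_all_countable indistinguishable_def)
    moreover have "(\<lambda>n. step_fun (k n) (c n) (a n) s) \<longlonglongrightarrow> y s" for s
    proof (cases "1 \<le> s")
      case False
      \<comment> \<open>A time \<open>s < 1\<close> precedes all but finitely many
        \<open>\<tau> m\<close>. As \<open>W m\<close> uses only indices from \<open>m\<close> on,
        it still vanishes at \<open>s\<close> for large \<open>m\<close>.\<close>
      then have "\<forall>\<^sub>F m in sequentially. s < \<tau> m"
        using \<tau>(3) by (intro order_tendstoD) auto
      then obtain n where n: "\<And>m. n \<le> m \<Longrightarrow> s < \<tau> m" by (auto simp: eventually_sequentially)
      have "\<forall>\<^sub>F m in sequentially. step_fun (k m) (c m) (a m) s = y s"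
        using eventually_ge_at_top[of n]
      proof eventually_elim
        case (elim m)
        have "s < a m i" if "i < k m" for i
          using a_in[OF that] n elim by auto
        then show ?case using False by (simp add: y step_fun_eq_0)
      qed
      then show ?thesis by (rule tendsto_eventually)
    qed (simp add: y w_1)
    ultimately show "AE \<omega> in M. (\<lambda>n. W n s \<omega>) \<longlonglongrightarrow> y s" if "0 \<le> s" for s
      by (auto simp: that elim: eventually_mono)
    \<comment> \<open>The inner limit is already the right-continuous path \<open>y\<close>, so the
      limit through rationals from the right returns its value.\<close>
    show "AE \<omega> in M. \<forall>t\<ge>0. (y \<longlongrightarrow> Y t \<omega>) (at t within \<rat> \<inter> {t<..})"
      using y_right unfolding Y_def y[symmetric] by (auto intro: tendsto_within_subset)
  qed
  show "is_iterated_limit M (\<lambda>n. ito_integral M F (left_limit Y) (W n)) (ito_integral M F (left_limit Y) Y)"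
    by (rule is_iterated_limit_const[OF YW YY]) simp
  show "\<exists>L. is_iterated_limit M (\<lambda>n. quadratic_covariation M F (W n) Y) L \<and>
      \<not> indistinguishable M L (quadratic_covariation M F Y Y)"
  proof (intro exI conjI)
    show "is_iterated_limit M (\<lambda>n. quadratic_covariation M F (W n) Y) (\<lambda>t \<omega>. 0)"
      by (rule is_iterated_limit_const[OF qWY]) (simp_all add: indistinguishable_def)
    show "\<not> indistinguishable M (\<lambda>t \<omega>. 0) (quadratic_covariation M F Y Y)"
    proof
      assume "indistinguishable M (\<lambda>t \<omega>. 0) (quadratic_covariation M F Y Y)"
      then have "AE \<omega> in M. \<forall>t\<ge>0. 0 = y t"
        using qYY unfolding indistinguishable_def by eventually_elim simp
      with ne show False by blast
    qed
  qed
  show "\<exists>L. is_iterated_limit M (\<lambda>n. ito_integral M F (left_limit (W n)) Y) L \<and>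
      \<not> indistinguishable M L (ito_integral M F (left_limit Y) Y)"
  proof (intro exI conjI)
    show "is_iterated_limit M (\<lambda>n. ito_integral M F (left_limit (W n)) Y) (\<lambda>t \<omega>. y t)"
      by (rule is_iterated_limit_const[OF WY _ y_right]) (simp add: indistinguishable_def)
    show "\<not> indistinguishable M (\<lambda>t \<omega>. y t) (ito_integral M F (left_limit Y) Y)"
    proof
      assume "indistinguishable M (\<lambda>t \<omega>. y t) (ito_integral M F (left_limit Y) Y)"
      then have "AE \<omega> in M. \<forall>t\<ge>0. y t = 0"
        using YY unfolding indistinguishable_def by eventually_elim simp
      with ne show False by blast
    qed
  qed
qed

end

theorem theorem3:
  fixes M :: "'a measure" and F :: "real \<Rightarrow> 'a measure"
  assumes "usual_filtered_prob_space M F"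
  shows "\<exists>(Y :: 'a process) (X :: nat \<Rightarrow> 'a process).
    semimartingale M F Y \<and>
    (\<forall>n. semimartingale M F (X n) \<and> (AE \<omega> in M. X n 0 \<omega> = 0)) \<and>
    (SUP n. \<integral>\<^sup>+ \<omega>. total_variation (\<lambda>t. X n t \<omega>) \<partial>M) \<le> 1 \<and>
    (\<forall>W :: nat \<Rightarrow> 'a process. (\<forall>n. W n \<in> process_convex_hull M {X m | m. m \<ge> n}) \<longrightarrow>
       is_iterated_limit M W Y) \<and>
    (\<forall>W :: nat \<Rightarrow> 'a process. (\<forall>n. W n \<in> process_convex_hull M {X m | m. m \<ge> n}) \<longrightarrow>
       is_iterated_limit M (\<lambda>n. ito_integral M F (left_limit Y) (W n))
         (ito_integral M F (left_limit Y) Y) \<and>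
       (\<exists>L. is_iterated_limit M (\<lambda>n. quadratic_covariation M F (W n) Y) L \<and>
         \<not> indistinguishable M L (quadratic_covariation M F Y Y)) \<and>
       (\<exists>L. is_iterated_limit M (\<lambda>n. ito_integral M F (left_limit (W n)) Y) L \<and>
         \<not> indistinguishable M L (ito_integral M F (left_limit Y) Y)))"
proof -
  interpret usual_filtered_prob_space M F by (rule assms)
  \<comment> \<open>The shift by two gives \<open>\<tau> 0 = 1 / 2\<close>; a shift by one would
    give \<open>\<tau> 0 = 0\<close>, and \<open>X 0\<close> would not start at zero.\<close>
  define \<tau> :: "nat \<Rightarrow> real" where "\<tau> n = 1 - inverse (real (Suc (Suc n)))" for n
  define Y :: "'a process" where "Y = (\<lambda>t \<omega>. indicator {1..} t)"
  define X :: "nat \<Rightarrow> 'a process" where "X n = (\<lambda>t \<omega>. indicator {\<tau> n..} t)" for n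
  have \<tau>: "0 < \<tau> n" "\<tau> n < 1" for n
    by (simp_all add: \<tau>_def inverse_eq_divide)
  have "(\<lambda>n. inverse (real (Suc (Suc n)))) \<longlonglongrightarrow> 0"
    by (rule LIMSEQ_Suc[OF LIMSEQ_inverse_real_of_nat])
  then have "\<tau> \<longlonglongrightarrow> 1 - 0"
    unfolding \<tau>_def by (intro tendsto_diff tendsto_const)
  then have lim: "\<tau> \<longlonglongrightarrow> 1" by simp
  note limits = left_accumulating_jumps_limits[OF \<tau> lim, folded Y_def X_def]
  show ?thesis
  proof (rule exI[of _ Y], rule exI[of _ X], intro conjI allI impI)
    show "semimartingale M F Y" "semimartingale M F (X n)" "AE \<omega> in M. X n 0 \<omega> = 0" for n
      using \<tau>(1)[of n] by (auto simp: X_def Y_def intro: semimartingale_indicator)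
    show "(SUP n. \<integral>\<^sup>+ \<omega>. total_variation (\<lambda>t. X n t \<omega>) \<partial>M) \<le> 1"
      using \<tau>(1) by (simp add: X_def total_variation_indicator emeasure_space_1)
  next
    fix W assume "\<forall>n. W n \<in> process_convex_hull M {X m | m. m \<ge> n}"
    then have W: "W n \<in> process_convex_hull M {X m | m. n \<le> m}" for n by blast
    show "is_iterated_limit M W Y"
      and "is_iterated_limit M (\<lambda>n. ito_integral M F (left_limit Y) (W n))
        (ito_integral M F (left_limit Y) Y)"
      and "\<exists>L. is_iterated_limit M (\<lambda>n. quadratic_covariation M F (W n) Y) L \<and>
        \<not> indistinguishable M L (quadratic_covariation M F Y Y)"
      and "\<exists>L. is_iterated_limit M (\<lambda>n. ito_integral M F (left_limit (W n)) Y) L \<and>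
        \<not> indistinguishable M L (ito_integral M F (left_limit Y) Y)"
      by (rule limits[OF W])+
  qed
qed

end
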